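(* Let $(P_n)_{n\geq 0}$ be the Padovan sequence, defined by $P_0=1$, $P_1=P_2=0$ and $P_n=P_{n-2}+P_{n-3}$ for $n\geq 3$. Then for all integers $n,k\geq 0$, $$P_{n+k}=P_{n+1}P_{k+2}+P_{n+2}P_{k+1}+P_nP_k.$$ *)

theory Defs
  imports Main
begin

fun padovan :: "nat \<Rightarrow> nat" where
  "padovan 0 = 1"
| "padovan (Suc 0) = 0"
| "padovan (Suc (Suc 0)) = 0"
| "padovan (Suc (Suc (Suc n))) = padovan (Suc n) + padovan n"

end

theory Submission
  imports Defs
begin

text \<open>For fixed \<open>k\<close>, both sides satisfy the Padovan recurrence as functions of \<open>n\<close>: the left
  side is a shift of the sequence, and the right side is a linear combination, with coefficients
  independent of \<open>n\<close>, of three shifts of it. A solution of this third-order recurrence is determined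
  by its values at \<open>0, 1, 2\<close>. There the two sides agree because the vectors
  \<open>(P\<^sub>n, P\<^sub>n\<^sub>+\<^sub>1, P\<^sub>n\<^sub>+\<^sub>2)\<close> for \<open>n = 0, 1, 2\<close> are the unit vectors
  \<open>(1, 0, 0)\<close>, \<open>(0, 0, 1)\<close>, \<open>(0, 1, 0)\<close>, so that exactly one term of the right side survives.\<close>

theorem corollary5:
  fixes n k :: nat
  shows "padovan (n + k) =
    padovan (n + 1) * padovan (k + 2) + padovan (n + 2) * padovan (k + 1) + padovan n * padovan k"
  by (induction n rule: padovan.induct) (simp_all add: algebra_simps eval_nat_numeral)

end
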